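(* Let $a\in\mathbb{R}$, $\alpha\in(0,1)$, and let $w:\mathbb{N}_a\to\mathbb{R}\setminus\{0\}$ satisfy $\frac{w(a)}{w(k)}>0$ for all $k\in\mathbb{N}_{a+1}$. Let $x:\mathbb{N}_a\to\mathbb{R}$ be such that $\nabla^{1,w(k)}x(k)\ge 0$ for all $k\in\mathbb{N}_{a+1}$. Then ${}_a^{\rm C}\nabla_k^{\alpha,w(k)}x(k)\ge 0$ for all $k\in\mathbb{N}_{a+1}$. Moreover, if in addition $x(a)\ge 0$, then ${}_a^{\rm R}\nabla_k^{\alpha,w(k)}x(k)\ge 0$ for all $k\in\mathbb{N}_{a+1}$.
   Context: For $a\in\mathbb{R}$, $\mathbb{N}_a:=\{a,a+1,a+2,\dots\}$. The nabla difference is $\nabla x(k):=x(k)-x(k-1)$. For $\beta\in(-1,1)$, the Grünwald–Letnikov difference/sum is $${}_a^{\rm G}\nabla_k^{\beta}x(k):=\sum_{i=0}^{k-a-1}(-1)^i\binom{\beta}{i}x(k-i),\qquad \binom{p}{q}:=\frac{\Gamma(p+1)}{\Gamma(q+1)\Gamma(p-q+1)},$$ with the empty sum (at $k=a$) equal to $0$. For $\alpha\in(0,1)$ and $k\in\mathbb{N}_{a+1}$, the Riemann–Liouville and Caputo differences are ${}_a^{\rm R}\nabla_k^{\alpha}x(k):=\nabla\,{}_a^{\rm G}\nabla_k^{\alpha-1}x(k)$ and ${}_a^{\rm C}\nabla_k^{\alpha}x(k):={}_a^{\rm G}\nabla_k^{\alpha-1}\nabla x(k)$. Given a tempered function $w$,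 the tempered operators are $\nabla^{1,w(k)}x(k):=w^{-1}(k)\nabla[w(k)x(k)]$, ${}_a^{\rm R}\nabla_k^{\alpha,w(k)}x(k):=w^{-1}(k)\,{}_a^{\rm R}\nabla_k^{\alpha}[w(k)x(k)]$ and ${}_a^{\rm C}\nabla_k^{\alpha,w(k)}x(k):=w^{-1}(k)\,{}_a^{\rm C}\nabla_k^{\alpha}[w(k)x(k)]$, where $w^{-1}(k)=1/w(k)$. *)

theory Defs
  imports "HOL-Analysis.Analysis"
begin

text \<open>
  Real sequences on the shifted grid \<open>{a, a + 1, \<dots>}\<close> are represented by total functions
  on the reals. At the points where the theorem evaluates them, the operators below only use
  values on that grid, so values elsewhere are irrelevant.
\<close>

definition nat_from :: "real \<Rightarrow> real set" where
  "nat_from a = {a + real n | n. True}"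

definition nabla :: "(real \<Rightarrow> real) \<Rightarrow> real \<Rightarrow> real" where
  "nabla x k = x k - x (k - 1)"

text \<open>
  The quotient \<open>1 / \<Gamma>\<close> is read as \<open>0\<close> at the poles of \<open>\<Gamma>\<close>, which
  is what the library conventions \<open>Gamma z = 0\<close> at poles and \<open>t / 0 = 0\<close> give.
\<close>

definition Gamma_binomial :: "real \<Rightarrow> real \<Rightarrow> real" where
  "Gamma_binomial p q = Gamma (p + 1) / (Gamma (q + 1) * Gamma (p - q + 1))"

lemma Gamma_binomial_eq_gbinomial:
  assumes "p + 1 \<notin> \<int>\<^sub>\<le>\<^sub>0"
  shows "Gamma_binomial p (real n) = p gchoose n"
  using gbinomial_Gamma[OF assms, of n]
  by (simp add: Gamma_binomial_def Gamma_fact add.commute)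

text \<open>
  The index set is \<open>{0, \<dots>, k - a - 1}\<close> for \<open>k\<close> on the grid; it is empty for \<open>k = a\<close>.
\<close>

definition GL_diff :: "real \<Rightarrow> real \<Rightarrow> (real \<Rightarrow> real) \<Rightarrow> real \<Rightarrow> real" where
  "GL_diff a \<beta> x k =
     (\<Sum>i | real i \<le> k - a - 1. (-1) ^ i * Gamma_binomial \<beta> (real i) * x (k - real i))"

definition RL_diff :: "real \<Rightarrow> real \<Rightarrow> (real \<Rightarrow> real) \<Rightarrow> real \<Rightarrow> real" where
  "RL_diff a \<alpha> x k = nabla (GL_diff a (\<alpha> - 1) x) k"

definition Caputo_diff :: "real \<Rightarrow> real \<Rightarrow> (real \<Rightarrow> real) \<Rightarrow> real \<Rightarrow> real" where
  "Caputo_diff a \<alpha> x k = GL_diff a (\<alpha> - 1) (nabla x) k"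

definition tempered_nabla :: "(real \<Rightarrow> real) \<Rightarrow> (real \<Rightarrow> real) \<Rightarrow> real \<Rightarrow> real" where
  "tempered_nabla w x k = 1 / w k * nabla (\<lambda>j. w j * x j) k"

definition tempered_RL_diff ::
    "real \<Rightarrow> real \<Rightarrow> (real \<Rightarrow> real) \<Rightarrow> (real \<Rightarrow> real) \<Rightarrow> real \<Rightarrow> real" where
  "tempered_RL_diff a \<alpha> w x k = 1 / w k * RL_diff a \<alpha> (\<lambda>j. w j * x j) k"

definition tempered_Caputo_diff ::
    "real \<Rightarrow> real \<Rightarrow> (real \<Rightarrow> real) \<Rightarrow> (real \<Rightarrow> real) \<Rightarrow> real \<Rightarrow> real" where
  "tempered_Caputo_diff a \<alpha> w x k = 1 / w k * Caputo_diff a \<alpha> (\<lambda>j. w j * x j) k"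

end

theory Submission
  imports Defs
begin

text \<open>
  For \<open>0 < \<alpha> < 1\<close> the weights \<open>(-1)\<^sup>i (\<alpha> - 1 choose i)\<close> of the fractional sum of order
  \<open>\<alpha> - 1\<close> equal the rising factorials of \<open>1 - \<alpha>\<close> divided by \<open>i!\<close>, so they are positive and
  the sum preserves nonnegativity (\<open>GL_diff_nonneg\<close>). The Caputo difference is this sum applied
  to \<open>\<nabla>(w x)\<close>. Since \<open>w\<close> has constant sign on the grid, \<open>\<nabla>(w x)(j)\<close> is zero or has
  the sign of \<open>w(k)\<close> at every grid point \<open>j\<close> after \<open>a\<close>, and division by \<open>w(k)\<close> gives a nonnegative
  sequence. The Riemann--Liouville difference differs from the Caputo difference only by a
  positive multiple of the initial value \<open>w(a) x(a)\<close> (\<open>RL_diff_eq_Caputo_diff_plus_initial\<close>),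
  and \<open>w(a) x(a) / w(k) \<ge> 0\<close> when \<open>x(a) \<ge> 0\<close>.
\<close>

lemma GL_diff_on_grid:
  "GL_diff a \<beta> f (a + real n) =
     (\<Sum>i<n. (-1) ^ i * Gamma_binomial \<beta> (real i) * f (a + real (n - i)))"
proof -
  have "{i. real i \<le> a + real n - a - 1} = {..<n}"
    by auto
  then show ?thesis
    unfolding GL_diff_def by (auto intro!: sum.cong simp: of_nat_diff algebra_simps)
qed

lemma GL_diff_scale: "GL_diff a \<beta> (\<lambda>j. c * f j) k = c * GL_diff a \<beta> f k"
  by (simp add: GL_diff_def sum_distrib_left mult.left_commute)

text \<open>
  Each factor of the falling factorial of \<open>\<beta>\<close> is negative for \<open>\<beta> < 0\<close>, so \<open>(-1)\<^sup>i\<close> cancels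
  the sign exactly. The bound \<open>-1 < \<beta>\<close> keeps the numerator \<open>\<Gamma> (\<beta> + 1)\<close> away from its poles.
\<close>

lemma GL_weight_pos:
  assumes "-1 < \<beta>" "\<beta> < 0"
  shows "0 < (-1) ^ i * Gamma_binomial \<beta> (real i)"
proof -
  have "\<beta> + 1 \<notin> \<int>\<^sub>\<le>\<^sub>0"
    using assms by (auto elim!: nonpos_Ints_cases)
  then have "(-1) ^ i * Gamma_binomial \<beta> (real i) = pochhammer (- \<beta>) i / fact i"
    by (simp add: Gamma_binomial_eq_gbinomial gbinomial_pochhammer
        flip: mult.assoc power_mult_distrib)
  also have "\<dots> > 0"
    using assms by (simp add: pochhammer_pos)
  finally show ?thesis .
qed

lemma GL_diff_nonneg:
  assumes "-1 < \<beta>" "\<beta> < 0"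
    and "\<And>m. 0 < m \<Longrightarrow> 0 \<le> f (a + real m)"
  shows "0 \<le> GL_diff a \<beta> f (a + real n)"
  unfolding GL_diff_on_grid
proof (rule sum_nonneg)
  fix i assume "i \<in> {..<n}"
  then have "0 \<le> f (a + real (n - i))"
    by (intro assms(3)) simp
  then show "0 \<le> (-1) ^ i * Gamma_binomial \<beta> (real i) * f (a + real (n - i))"
    by (rule mult_nonneg_nonneg[OF less_imp_le[OF GL_weight_pos[OF assms(1,2)]]])
qed

text \<open>
  The fractional sum at \<open>k\<close> has one more term than the sum at \<open>k - 1\<close>. When equal weights are
  paired, the last term, a multiple of \<open>f (a + 1)\<close>, stands alone. Writing \<open>f (a + 1)\<close>
  as \<open>\<nabla>f (a + 1) + f a\<close> completes the Caputo difference and leaves the initial value.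
\<close>

lemma RL_diff_eq_Caputo_diff_plus_initial:
  "RL_diff a \<alpha> f (a + real (Suc n)) =
     Caputo_diff a \<alpha> f (a + real (Suc n)) + (-1) ^ n * Gamma_binomial (\<alpha> - 1) (real n) * f a"
proof -
  define c where "c i = (-1) ^ i * Gamma_binomial (\<alpha> - 1) (real i)" for i
  have "RL_diff a \<alpha> f (a + real (Suc n)) =
      (\<Sum>i<Suc n. c i * f (a + real (Suc n - i))) - (\<Sum>i<n. c i * f (a + real (n - i)))"
    using GL_diff_on_grid[of a "\<alpha> - 1" f "Suc n"] GL_diff_on_grid[of a "\<alpha> - 1" f n]
    by (simp add: RL_diff_def nabla_def c_def add.commute add.left_commute)
  also have "\<dots> = (\<Sum>i<Suc n. c i * f (a + real (Suc n - i)))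
      - (\<Sum>i<Suc n. c i * f (a + real (n - i))) + c n * f a"
    by simp
  also have "\<dots> = (\<Sum>i<Suc n. c i * nabla f (a + real (Suc n - i))) + c n * f a"
    unfolding sum_subtractf[symmetric]
    by (intro arg_cong2[of _ _ _ _ "(+)"] sum.cong refl)
      (auto simp: nabla_def Suc_diff_le algebra_simps)
  also have "\<dots> = Caputo_diff a \<alpha> f (a + real (Suc n)) + c n * f a"
    by (simp only: Caputo_diff_def GL_diff_on_grid c_def)
  finally show ?thesis
    by (simp add: c_def)
qed

theorem theorem3p2:
  fixes a \<alpha> :: real and w x :: "real \<Rightarrow> real"
  assumes "0 < \<alpha>" and "\<alpha> < 1"
    and "\<forall>k\<in>nat_from a. w k \<noteq> 0"
    and "\<forall>k\<in>nat_from (a + 1). w a / w k > 0"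
    and "\<forall>k\<in>nat_from (a + 1). tempered_nabla w x k \<ge> 0"
  shows "(\<forall>k\<in>nat_from (a + 1). tempered_Caputo_diff a \<alpha> w x k \<ge> 0) \<and>
         (x a \<ge> 0 \<longrightarrow> (\<forall>k\<in>nat_from (a + 1). tempered_RL_diff a \<alpha> w x k \<ge> 0))"
proof -
  define y where "y = (\<lambda>j. w j * x j)"
  have grid: "k \<in> nat_from (a + 1) \<longleftrightarrow> (\<exists>n. k = a + real (Suc n))" for k
    by (auto simp: nat_from_def add_ac)
  have in_grid: "a + real m \<in> nat_from (a + 1)" if "0 < m" for m
    using that grid gr0_implies_Suc by blast
  have caputo: "0 \<le> 1 / w k * Caputo_diff a \<alpha> y k" if k: "k = a + real (Suc n)" for k n
  proof -
    have "0 \<le> 1 / w k * nabla y (a + real m)" if "0 < m" for m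
    proof -
      define j where "j = a + real m"
      have pos: "0 < w a / w k" "0 < w a / w j"
        using assms(4) in_grid[of "Suc n"] in_grid[OF that] k by (auto simp: j_def)
      then have "0 < w j / w k"
        by (auto simp: zero_less_divide_iff)
      moreover have "0 \<le> tempered_nabla w x j"
        using assms(5) in_grid[OF that] by (simp add: j_def)
      ultimately have "0 \<le> w j / w k * tempered_nabla w x j"
        by (rule mult_nonneg_nonneg[OF less_imp_le])
      also have "\<dots> = 1 / w k * nabla y j"
        using pos by (auto simp: tempered_nabla_def y_def)
      finally show ?thesis
        by (simp add: j_def)
    qed
    then have "0 \<le> GL_diff a (\<alpha> - 1) (\<lambda>j. 1 / w k * nabla y j) k"
      unfolding k using assms(1,2) by (intro GL_diff_nonneg) auto
    then show ?thesis
      by (simp only: GL_diff_scale Caputo_diff_def)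
  qed
  moreover have "0 \<le> 1 / w k * RL_diff a \<alpha> y k" if k: "k = a + real (Suc n)" and "0 \<le> x a" for k n
  proof -
    have "0 < w a / w k"
      using assms(4) in_grid[of "Suc n"] k by auto
    moreover have "0 < (-1) ^ n * Gamma_binomial (\<alpha> - 1) (real n)" (is "0 < ?c")
      using assms(1,2) by (intro GL_weight_pos) auto
    ultimately have "0 \<le> ?c * (w a / w k * x a)"
      using \<open>0 \<le> x a\<close> by (metis less_imp_le mult_nonneg_nonneg)
    moreover have "1 / w k * RL_diff a \<alpha> y k =
        1 / w k * Caputo_diff a \<alpha> y k + ?c * (w a / w k * x a)"
      unfolding k RL_diff_eq_Caputo_diff_plus_initial y_def
      by (simp only: distrib_left) simp
    ultimately show ?thesis
      using caputo[OF k] by (simp only: add_nonneg_nonneg)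
  qed
  ultimately show ?thesis
    unfolding tempered_Caputo_diff_def tempered_RL_diff_def y_def[symmetric] Ball_def grid
    by iprover
qed

end
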